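(* Let $q$ be a prime power and assume that $n$ and $k$ are two positive integers with $0<k<n$. Then the number of distinct symplectic LCD $[2n,2k]_q$ codes is $$|{\rm SLCD}[2n,2k]_q|=q^{2k(n-k)}\begin{bmatrix} n \\ k \end{bmatrix}_{q^2}.$$
   Context: A linear $[m,k]_q$ code is a $k$-dimensional subspace of $\mathbb{F}_q^m$. On $\mathbb{F}_q^{2n}$ the symplectic inner product is $\langle \mathbf{x},\mathbf{y}\rangle_{\rm s}=\sum_{i=1}^n(x_iy_{n+i}-x_{n+i}y_i)$. For a code $C\subseteq\mathbb{F}_q^{2n}$, $C^{\perp_{\rm s}}=\{\mathbf{y}\in\mathbb{F}_q^{2n} : \langle\mathbf{x},\mathbf{y}\rangle_{\rm s}=0\text{ for all }\mathbf{x}\in C\}$, and $C$ is symplectic LCD if $C\cap C^{\perp_{\rm s}}=\{\mathbf{0}\}$. ${\rm SLCD}[2n,2k]_q$ denotes the set of all symplectic LCD $[2n,2k]_q$ codes. The Gaussian binomial coefficient is $\begin{bmatrix} n\\k\end{bmatrix}_Q=\frac{(Q^n-1)(Q^n-Q)\cdots(Q^n-Q^{k-1})}{(Q^k-1)(Q^k-Q)\cdots(Q^k-Q^{k-1})}$ for $k\neq 0$, and here it is taken with $Q=q^2$. *)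

theory Defs
  imports "HOL-Analysis.Cartesian_Space" "HOL-Number_Theory.Prime_Powers"
begin

text \<open>
  The ambient space of dimension \<open>2 n\<close> over a field is \<open>'a ^ ('n + 'n)\<close> with
  \<open>n = CARD('n)\<close>: for an index \<open>i :: 'n\<close>, the component at \<open>Inl i\<close> is the i-th coordinate
  and the component at \<open>Inr i\<close> is the (n+i)-th coordinate.
\<close>

definition linear_code :: "nat \<Rightarrow> nat \<Rightarrow> ('a::field ^ 'm::finite) set \<Rightarrow> bool" where
  "linear_code m k C \<longleftrightarrow> CARD('m) = m \<and> vec.subspace C \<and> vec.dim C = k"

definition symp_inner :: "'a::field ^ ('n::finite + 'n) \<Rightarrow> 'a ^ ('n + 'n) \<Rightarrow> 'a" where
  "symp_inner x y = (\<Sum>i\<in>UNIV. x $ Inl i * y $ Inr i - x $ Inr i * y $ Inl i)"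

definition symp_dual :: "('a::field ^ ('n::finite + 'n)) set \<Rightarrow> ('a ^ ('n + 'n)) set" where
  "symp_dual C = {y. \<forall>x\<in>C. symp_inner x y = 0}"

definition symp_LCD :: "('a::field ^ ('n::finite + 'n)) set \<Rightarrow> bool" where
  "symp_LCD C \<longleftrightarrow> C \<inter> symp_dual C = {0}"

definition SLCD :: "nat \<Rightarrow> nat \<Rightarrow> ('a::field ^ ('n::finite + 'n)) set set" where
  "SLCD m d = {C. linear_code m d C \<and> symp_LCD C}"

text \<open>
  The quotient is taken in a field, so that no truncation occurs; for \<open>k = 0\<close> both products
  are empty and the value is 1.
\<close>

definition gaussian_binomial :: "'b::field \<Rightarrow> nat \<Rightarrow> nat \<Rightarrow> 'b" where
  "gaussian_binomial Q n k = (\<Prod>i<k. Q ^ n - Q ^ i) / (\<Prod>i<k. Q ^ k - Q ^ i)"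

end

theory Submission
  imports Defs
begin

text \<open>
  Count the pairs of a code in \<open>SLCD[2n,2k]\<close> and an ordered list of \<open>k\<close> mutually orthogonal
  hyperbolic pairs inside it. A nondegenerate space with \<open>q^(2m)\<close> elements contains
  \<open>\<Prod>i<k. (q^(2(m-i)) - 1) q^(2(m-i)-1)\<close> such lists: the first vector is any nonzero one, its
  partner lies in an affine hyperplane, and the rest lies in the orthogonal complement of
  the pair, which is nondegenerate again. As every list of length \<open>k\<close> in the ambient space
  lies in exactly one code of \<open>SLCD[2n,2k]\<close>, namely its span, the number of codes is the
  quotient of these products for \<open>m = n\<close> and for \<open>m = k\<close>.
\<close>

subsection \<open>The symplectic form\<close>

lemma symp_inner_add_right: "symp_inner x (y + z) = symp_inner x y + symp_inner x z"
  by (simp add: symp_inner_def algebra_simps sum.distrib sum_subtractf)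

lemma symp_inner_scale_right: "symp_inner x (a *s y) = a * symp_inner x y"
  by (simp add: symp_inner_def algebra_simps sum_distrib_left sum_subtractf)

lemma symp_inner_self [simp]: "symp_inner x x = 0"
  by (simp add: symp_inner_def)

lemma symp_inner_commute: "symp_inner y x = - symp_inner x y"
  by (simp add: symp_inner_def sum_negf[symmetric] algebra_simps)

lemma symp_inner_add_left: "symp_inner (x + y) z = symp_inner x z + symp_inner y z"
  by (simp add: symp_inner_def algebra_simps sum.distrib sum_subtractf)

lemma symp_inner_scale_left: "symp_inner (a *s x) y = a * symp_inner x y"
  by (simp add: symp_inner_def algebra_simps sum_distrib_left sum_subtractf)

lemma symp_inner_zero [simp]: "symp_inner x 0 = 0" "symp_inner 0 x = 0"
  by (simp_all add: symp_inner_def)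

lemma symp_inner_diff_right: "symp_inner x (y - z) = symp_inner x y - symp_inner x z"
  using symp_inner_add_right[of x "y - z" z] by simp

lemmas symp_inner_simps =
  symp_inner_diff_right symp_inner_add_right symp_inner_scale_right symp_inner_add_left symp_inner_scale_left

lemma subspace_symp_dual: "vec.subspace (symp_dual C)"
  by (auto simp: vec.subspace_def symp_dual_def symp_inner_simps)

text \<open>The form couples coordinate \<open>Inl i\<close> with \<open>Inr i\<close> only, so
  testing a vector against the unit vector at one of these indices isolates its entry at the other,
  up to sign.\<close>

lemma symp_LCD_UNIV: "symp_LCD (UNIV :: ('a::field ^ ('n::finite + 'n)) set)"
proof -
  have "y = 0" if *: "\<And>x. symp_inner x y = 0" for y :: "'a ^ ('n + 'n)"
  proof -
    have "y $ Inr i = 0" for i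
      using *[of "axis (Inl i) 1"]
      by (simp add: symp_inner_def axis_def if_distrib[of "\<lambda>x. x * _"] cong: if_cong)
    moreover have "y $ Inl i = 0" for i
      using *[of "axis (Inr i) 1"]
      by (simp add: symp_inner_def axis_def if_distrib[of "\<lambda>x. x * _"] sum_negf cong: if_cong)
    ultimately show ?thesis
      by (metis obj_sumE vec_eq_iff zero_index)
  qed
  then show ?thesis
    by (auto simp: symp_LCD_def symp_dual_def)
qed

lemma symp_LCD_nondegenerate:
  assumes "symp_LCD W" "x \<in> W" "\<And>y. y \<in> W \<Longrightarrow> symp_inner y x = 0"
  shows "x = 0"
  using assms by (auto simp: symp_LCD_def symp_dual_def)

subsection \<open>Cardinalities\<close>

text \<open>Each new basis vector multiplies the cardinality by \<open>CARD('a)\<close>: its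
  coefficient is free, and independence makes it unique.\<close>

lemma card_span_independent:
  fixes B :: "('a::{field,finite} ^ 'm::finite) set"
  assumes "vec.independent B"
  shows "card (vec.span B) = CARD('a) ^ card B"
  using finite[of B] assms
proof (induction B)
  case empty
  then show ?case by simp
next
  case (insert b B)
  let ?f = "\<lambda>(k, x). k *s b + x"
  have b: "b \<notin> vec.span B" and B: "vec.independent B"
    using insert by (auto simp: vec.independent_insert)
  have "inj_on ?f (UNIV \<times> vec.span B)"
  proof (rule inj_onI, clarsimp)
    fix k l x y
    assume x: "x \<in> vec.span B" and y: "y \<in> vec.span B" and eq: "k *s b + x = l *s b + y"
    have *: "(k - l) *s b = y - x"
      using eq by (simp add: algebra_simps)
    have "k = l"
    proof (rule ccontr)
      assume "k \<noteq> l"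
      then have "b = inverse (k - l) *s (y - x)"
        by (simp flip: *)
      with b x y show False
        by (metis vec.span_diff vec.span_scale)
    qed
    with eq show "k = l \<and> x = y" by simp
  qed
  moreover have "vec.span (insert b B) = ?f ` (UNIV \<times> vec.span B)"
  proof (intro set_eqI iffI)
    fix x assume "x \<in> vec.span (insert b B)"
    then obtain k where "x - k *s b \<in> vec.span B" by (auto simp: vec.span_insert)
    then show "x \<in> ?f ` (UNIV \<times> vec.span B)"
      by (intro image_eqI[of _ _ "(k, x - k *s b)"]) auto
  next
    fix x assume "x \<in> ?f ` (UNIV \<times> vec.span B)"
    then obtain k y where "x = k *s b + y" "y \<in> vec.span B" by auto
    then show "x \<in> vec.span (insert b B)"
      by (auto simp: vec.span_insert intro!: exI[of _ k])
  qed
  ultimately show ?case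
    using insert B by (simp add: card_image)
qed

lemma card_subspace:
  fixes W :: "('a::{field,finite} ^ 'm::finite) set"
  assumes "vec.subspace W"
  shows "card W = CARD('a) ^ vec.dim W"
proof -
  obtain B where B: "B \<subseteq> W" "vec.independent B" "W \<subseteq> vec.span B" "card B = vec.dim W"
    using vec.basis_exists by blast
  then have "vec.span B = W"
    using assms by (metis subset_antisym vec.span_minimal)
  then show ?thesis
    using card_span_independent[OF B(2)] B by simp
qed

lemma card_field_gt_1: "CARD('a::{field,finite}) > 1"
  using card_mono[of UNIV "{0, 1 :: 'a}"] by simp

text \<open>Lets the later counting work with cardinalities instead of dimensions.\<close>

lemma dim_eq_iff_card:
  fixes W :: "('a::{field,finite} ^ 'm::finite) set"
  assumes "vec.subspace W"
  shows "vec.dim W = d \<longleftrightarrow> card W = CARD('a) ^ d"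
  using card_subspace[OF assms] card_field_gt_1[where 'a='a] by simp

subsection \<open>Hyperbolic pairs\<close>

text \<open>The coefficients are recoverable: pairing the sum with \<open>u\<close> returns
  \<open>b\<close> and pairing it with \<open>v\<close> returns \<open>-a\<close>, because
  \<open>S\<close> is orthogonal to both.\<close>

lemma card_plane_sum:
  fixes u v :: "'a::{field,finite} ^ ('n::finite + 'n)"
  assumes "symp_inner u v = 1" "S \<subseteq> symp_dual {u, v}"
  shows "card ((\<lambda>(a, b, w). a *s u + b *s v + w) ` (UNIV \<times> UNIV \<times> S)) = CARD('a) ^ 2 * card S"
proof -
  have vu: "symp_inner v u = -1" using assms(1) symp_inner_commute[of v u] by simp
  have "inj_on (\<lambda>(a, b, w). a *s u + b *s v + w) (UNIV \<times> UNIV \<times> S)"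
  proof (rule inj_onI, clarsimp)
    fix a b w a' b' w'
    assume w: "w \<in> S" "w' \<in> S" and eq: "a *s u + b *s v + w = a' *s u + b' *s v + w'"
    then have "symp_inner u w = 0" "symp_inner u w' = 0" "symp_inner v w = 0" "symp_inner v w' = 0"
      using assms(2) by (auto simp: symp_dual_def)
    moreover have "symp_inner u (a *s u + b *s v + w) = symp_inner u (a' *s u + b' *s v + w')"
      "symp_inner v (a *s u + b *s v + w) = symp_inner v (a' *s u + b' *s v + w')"
      by (simp_all only: eq)
    ultimately have "b = b'" "a = a'"
      using assms(1) vu by (simp_all add: symp_inner_simps)
    with eq show "a = a' \<and> b = b' \<and> w = w'" by simp
  qed
  then show ?thesis
    by (simp add: card_image card_cartesian_product power2_eq_square)
qed

text \<open>The subtracted part is the orthogonal projection of \<open>x\<close> onto the plane of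
  the hyperbolic pair; the coefficient of each basis vector is a pairing with the other one.\<close>

lemma plane_decomposition:
  fixes u v :: "'a::field ^ ('n::finite + 'n)"
  assumes "symp_inner u v = 1"
  shows "x - symp_inner x v *s u - symp_inner u x *s v \<in> symp_dual {u, v}"
proof -
  have vu: "symp_inner v u = -1" using assms symp_inner_commute[of v u] by simp
  then show ?thesis
    using assms by (auto simp: symp_dual_def symp_inner_simps symp_inner_commute[of x v])
qed

lemma plane_sum_eq_subspace:
  fixes u v :: "'a::field ^ ('n::finite + 'n)"
  assumes "vec.subspace W" "u \<in> W" "v \<in> W" "symp_inner u v = 1"
  shows "(\<lambda>(a, b, w). a *s u + b *s v + w) ` (UNIV \<times> UNIV \<times> (W \<inter> symp_dual {u, v})) = W"
    (is "?R = _")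
proof (intro subset_antisym subsetI)
  fix x assume "x \<in> W"
  then have "x - symp_inner x v *s u - symp_inner u x *s v \<in> W \<inter> symp_dual {u, v}"
    using assms by (auto intro!: vec.subspace_diff vec.subspace_scale plane_decomposition)
  then show "x \<in> ?R"
    by (intro image_eqI[of _ _
          "(symp_inner x v, symp_inner u x, x - symp_inner x v *s u - symp_inner u x *s v)"])
       (auto simp: algebra_simps)
next
  fix x assume "x \<in> ?R"
  then show "x \<in> W"
    using assms by (auto intro!: vec.subspace_add vec.subspace_scale)
qed

text \<open>A radical vector of the complement is orthogonal to the complement and to
  \<open>u\<close> and \<open>v\<close>, hence to all of \<open>W\<close> by the decomposition, so
  it vanishes.\<close>

lemma symp_LCD_plane_complement:
  fixes W :: "('a::field ^ ('n::finite + 'n)) set"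
  assumes W: "vec.subspace W" "symp_LCD W" and uv: "u \<in> W" "v \<in> W" "symp_inner u v = 1"
  shows "symp_LCD (W \<inter> symp_dual {u, v})"
proof -
  have "x = 0" if x: "x \<in> W" "x \<in> symp_dual {u, v}" "x \<in> symp_dual (W \<inter> symp_dual {u, v})" for x
  proof (rule symp_LCD_nondegenerate[OF W(2) x(1)])
    fix y assume "y \<in> W"
    then obtain a b w where "y = a *s u + b *s v + w" "w \<in> W \<inter> symp_dual {u, v}"
      using plane_sum_eq_subspace[OF W(1) uv] by (force simp: image_iff)
    then show "symp_inner y x = 0"
      using x by (auto simp: symp_dual_def symp_inner_simps)
  qed
  moreover have "0 \<in> W" "0 \<in> symp_dual C" for C :: "('a ^ ('n + 'n)) set"
    using W(1) subspace_symp_dual vec.subspace_0 by auto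
  ultimately show ?thesis
    by (auto simp: symp_LCD_def)
qed

text \<open>Pairing with \<open>u\<close> is a nonzero functional on \<open>W\<close>, so its level
  sets all have the same size, one for each field element. They are translates of one another along
  \<open>z\<close>.\<close>

lemma card_partners:
  fixes W :: "('a::{field,finite} ^ ('n::finite + 'n)) set"
  assumes W: "vec.subspace W" "symp_LCD W" and u: "u \<in> W" "u \<noteq> 0"
  shows "card W = CARD('a) * card {v \<in> W. symp_inner u v = 1}"
proof -
  obtain v where v: "v \<in> W" "symp_inner v u \<noteq> 0"
    using symp_LCD_nondegenerate[OF W(2) u(1)] u(2) by blast
  \<comment> \<open>Rescaling a vector not orthogonal to \<open>u\<close> gives a partner of
    \<open>u\<close>.\<close>
  define z where "z = inverse (symp_inner u v) *s v"
  have "symp_inner u v \<noteq> 0" using v(2) symp_inner_commute[of v u] by simp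
  then have z: "z \<in> W" "symp_inner u z = 1"
    using W(1) v by (auto simp: z_def symp_inner_simps intro: vec.subspace_scale)
  let ?f = "\<lambda>(a, v). v + a *s z"
  let ?A = "UNIV \<times> {v \<in> W. symp_inner u v = 1}"
  have "inj_on ?f ?A"
  proof (rule inj_onI, clarsimp)
    fix a b x y
    assume xy: "symp_inner u x = 1" "symp_inner u y = 1" and eq: "x + a *s z = y + b *s z"
    have "symp_inner u (x + a *s z) = symp_inner u (y + b *s z)" by (simp only: eq)
    then have "a = b" using xy z by (simp add: symp_inner_simps)
    with eq show "a = b \<and> x = y" by simp
  qed
  moreover have "?f ` ?A = W"
  proof (intro subset_antisym subsetI)
    fix x assume "x \<in> W"
    \<comment> \<open>Chosen so that subtracting \<open>?a *s z\<close> brings the pairing with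
      \<open>u\<close> to 1.\<close>
    let ?a = "symp_inner u x - 1"
    have "x - ?a *s z \<in> {v \<in> W. symp_inner u v = 1}"
      using W(1) z \<open>x \<in> W\<close> by (auto simp: symp_inner_simps intro: vec.subspace_diff vec.subspace_scale)
    then show "x \<in> ?f ` ?A"
      by (intro image_eqI[of _ _ "(?a, x - ?a *s z)"]) auto
  qed (use W(1) z in \<open>auto intro: vec.subspace_add vec.subspace_scale\<close>)
  ultimately show ?thesis
    using card_image[of ?f ?A] by (simp add: card_cartesian_product)
qed

lemma card_hyperbolic_pairs:
  fixes W :: "('a::{field,finite} ^ ('n::finite + 'n)) set"
  assumes W: "vec.subspace W" "symp_LCD W" and card: "card W = CARD('a) ^ Suc d"
  shows "card {(u, v). u \<in> W \<and> v \<in> W \<and> symp_inner u v = 1} =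
    (CARD('a) ^ Suc d - 1) * CARD('a) ^ d"
proof -
  have "card {v \<in> W. symp_inner u v = 1} = CARD('a) ^ d" if "u \<in> W - {0}" for u
    using card_partners[OF W, of u] that card by simp
  \<comment> \<open>The zero vector has no partner, so only nonzero \<open>u\<close> occur.\<close>
  moreover have "{(u, v). u \<in> W \<and> v \<in> W \<and> symp_inner u v = 1} =
      (SIGMA u : W - {0}. {v \<in> W. symp_inner u v = 1})"
    by auto
  moreover have "0 \<in> W" using W(1) vec.subspace_0 by blast
  ultimately show ?thesis
    using card by simp
qed

subsection \<open>Lists of mutually orthogonal hyperbolic pairs\<close>

text \<open>Each pair is tested only against the later ones; antisymmetry of the form covers the
  opposite order. The recursion matches splitting off the first pair and passing to its orthogonal
  complement.\<close>

fun hyperbolic :: "(('a::field ^ ('n::finite + 'n)) \<times> ('a ^ ('n + 'n))) list \<Rightarrow> bool" where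
  "hyperbolic [] \<longleftrightarrow> True"
| "hyperbolic ((u, v) # L) \<longleftrightarrow> symp_inner u v = 1 \<and>
     set L \<subseteq> symp_dual {u, v} \<times> symp_dual {u, v} \<and> hyperbolic L"

definition hyperbolic_lists ::
  "nat \<Rightarrow> ('a::field ^ ('n::finite + 'n)) set \<Rightarrow> (('a ^ ('n + 'n)) \<times> ('a ^ ('n + 'n))) list set"
  where "hyperbolic_lists k W = {L. length L = k \<and> hyperbolic L \<and> set L \<subseteq> W \<times> W}"

lemma finite_hyperbolic_lists [simp]:
  "finite (hyperbolic_lists k (W :: ('a::{field,finite} ^ ('n::finite + 'n)) set))"
  by (rule finite_subset[OF _ finite_lists_length_eq[of "W \<times> W" k]])
     (auto simp: hyperbolic_lists_def)

lemma hyperbolic_lists_0 [simp]: "hyperbolic_lists 0 W = {[]}"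
  by (auto simp: hyperbolic_lists_def)

lemma hyperbolic_lists_Suc:
  "hyperbolic_lists (Suc k) W = (\<lambda>(p, L). p # L) `
    (SIGMA p : {(u, v). u \<in> W \<and> v \<in> W \<and> symp_inner u v = 1}.
       hyperbolic_lists k (W \<inter> symp_dual {fst p, snd p}))" (is "_ = _ ` ?S")
proof (intro subset_antisym subsetI)
  fix M assume M: "M \<in> hyperbolic_lists (Suc k) W"
  then obtain u v L where "M = (u, v) # L"
    by (cases M) (auto simp: hyperbolic_lists_def)
  with M show "M \<in> (\<lambda>(p, L). p # L) ` ?S"
    by (intro image_eqI[of _ _ "((u, v), L)"]) (auto simp: hyperbolic_lists_def)
qed (auto simp: hyperbolic_lists_def)

lemma card_hyperbolic_lists:
  fixes W :: "('a::{field,finite} ^ ('n::finite + 'n)) set"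
  assumes "vec.subspace W" "symp_LCD W" "card W = CARD('a) ^ (2 * m)" "k \<le> m"
  shows "card (hyperbolic_lists k W) =
    (\<Prod>i<k. (CARD('a) ^ (2 * (m - i)) - 1) * CARD('a) ^ (2 * (m - i) - 1))"
  using assms
proof (induction k arbitrary: W m)
  case 0
  then show ?case by simp
next
  case (Suc k)
  then obtain m' where m: "m = Suc m'" by (cases m) auto
  let ?P = "{(u, v). u \<in> W \<and> v \<in> W \<and> symp_inner u v = 1}"
  let ?N = "\<Prod>i<k. (CARD('a) ^ (2 * (m' - i)) - 1) * CARD('a) ^ (2 * (m' - i) - 1)"
  have "card (hyperbolic_lists k (W \<inter> symp_dual {fst p, snd p})) = ?N" if p_in: "p \<in> ?P" for p
  proof -
    obtain u v where p: "p = (u, v)" "u \<in> W" "v \<in> W" "symp_inner u v = 1"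
      using p_in by auto
    \<comment> \<open>\<open>W\<close> is the plane of \<open>u\<close> and \<open>v\<close> plus
      its complement in \<open>W\<close>, so the complement is smaller by the factor
      \<open>CARD('a) ^ 2\<close>.\<close>
    have "CARD('a) ^ (2 * m) = CARD('a) ^ 2 * card (W \<inter> symp_dual {u, v})"
      using card_plane_sum[OF p(4), of "W \<inter> symp_dual {u, v}"]
        plane_sum_eq_subspace[OF Suc.prems(1) p(2-4)] Suc.prems(3) by simp
    then have "card (W \<inter> symp_dual {u, v}) = CARD('a) ^ (2 * m')"
      by (simp add: m power_add power2_eq_square)
    then show ?thesis
      using Suc.IH[of "W \<inter> symp_dual {u, v}" m'] Suc.prems p m
        symp_LCD_plane_complement[OF Suc.prems(1,2) p(2-4)]
      by (simp add: vec.subspace_inter subspace_symp_dual)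
  qed
  then have "(\<Sum>p\<in>?P. card (hyperbolic_lists k (W \<inter> symp_dual {fst p, snd p}))) = (\<Sum>p\<in>?P. ?N)"
    by (rule sum.cong[OF refl])
  then have "card (hyperbolic_lists (Suc k) W) = card ?P * ?N"
    unfolding hyperbolic_lists_Suc by (subst card_image) (force simp: inj_on_def, simp)
  also have "card ?P = (CARD('a) ^ (2 * m) - 1) * CARD('a) ^ (2 * m - 1)"
    using card_hyperbolic_pairs[OF Suc.prems(1,2), of "2 * m - 1"] Suc.prems(3) m by simp
  \<comment> \<open>The pairs supply the factor at index 0; the remaining factors shift, since
    \<open>m - Suc i = m' - i\<close>.\<close>
  finally show ?case
    by (simp add: prod.lessThan_Suc_shift m del: prod.lessThan_Suc power_Suc)
qed

definition list_span :: "(('a::field ^ 'm::finite) \<times> ('a ^ 'm)) list \<Rightarrow> ('a ^ 'm) set" where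
  "list_span L = vec.span (fst ` set L \<union> snd ` set L)"

lemma list_span_Cons:
  "list_span ((u, v) # L) = (\<lambda>(a, b, w). a *s u + b *s v + w) ` (UNIV \<times> UNIV \<times> list_span L)"
    (is "_ = ?R")
proof -
  have span: "list_span ((u, v) # L) = vec.span (insert u (insert v (fst ` set L \<union> snd ` set L)))"
    by (simp add: list_span_def insert_commute)
  show ?thesis
  proof (intro subset_antisym subsetI)
    fix x assume "x \<in> list_span ((u, v) # L)"
    then obtain a b where "x - a *s u - b *s v \<in> list_span L"
      unfolding span by (auto simp: list_span_def vec.span_insert)
    then show "x \<in> ?R"
      by (intro image_eqI[of _ _ "(a, b, x - a *s u - b *s v)"]) auto
  next
    fix x assume "x \<in> ?R"
    then obtain a b w where "x = a *s u + b *s v + w" "w \<in> list_span L" by auto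
    then have "x - a *s u - b *s v \<in> list_span L" by simp
    then show "x \<in> list_span ((u, v) # L)"
      unfolding span by (auto simp: list_span_def vec.span_insert)
  qed
qed

text \<open>The span of the tail is orthogonal to the head pair, so prepending the pair adds a
  nondegenerate plane: two dimensions are gained and the radical stays zero.\<close>

lemma hyperbolic_span:
  fixes L :: "(('a::{field,finite} ^ ('n::finite + 'n)) \<times> ('a ^ ('n + 'n))) list"
  assumes "hyperbolic L"
  shows "symp_LCD (list_span L) \<and> card (list_span L) = CARD('a) ^ (2 * length L)"
  using assms
proof (induction L)
  case Nil
  then show ?case by (simp add: list_span_def symp_LCD_def symp_dual_def)
next
  case (Cons p L)
  obtain u v where p: "p = (u, v)" by force
  with Cons have uv: "symp_inner u v = 1" and vu: "symp_inner v u = -1"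
    and L: "set L \<subseteq> symp_dual {u, v} \<times> symp_dual {u, v}" "hyperbolic L"
    using symp_inner_commute[of v u] by auto
  have sub: "list_span L \<subseteq> symp_dual {u, v}"
    unfolding list_span_def using L(1) by (intro vec.span_minimal subspace_symp_dual) auto
  have "x = 0" if x_in: "x \<in> list_span (p # L)" and x_dual: "x \<in> symp_dual (list_span (p # L))" for x
  proof -
    obtain a b w where x: "x = a *s u + b *s v + w" and w: "w \<in> list_span L"
      using x_in by (auto simp: p list_span_Cons)
    have orth: "symp_inner y x = 0" if "y \<in> list_span (p # L)" for y
      using x_dual that by (auto simp: symp_dual_def)
    have "u \<in> list_span (p # L)" "v \<in> list_span (p # L)"
      by (auto simp: list_span_def p intro: vec.span_base)
    then have "symp_inner u x = 0" "symp_inner v x = 0"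
      using orth by auto
    moreover have "symp_inner u w = 0" "symp_inner v w = 0"
      using sub w by (auto simp: symp_dual_def)
    \<comment> \<open>Pairing \<open>x\<close> with \<open>v\<close> gives \<open>-a\<close> and
      with \<open>u\<close> gives \<open>b\<close>, and both pairings are zero.\<close>
    ultimately have "a = 0" "b = 0"
      using uv vu by (auto simp: x symp_inner_simps)
    then have "x = w" by (simp add: x)
    moreover have "list_span L \<subseteq> list_span (p # L)"
      unfolding list_span_def by (intro vec.span_mono) auto
    ultimately show "x = 0"
      using symp_LCD_nondegenerate[of "list_span L" w] Cons.IH L(2) w orth by blast
  qed
  moreover have "0 \<in> list_span (p # L)" "0 \<in> symp_dual (list_span (p # L))"
    by (auto simp: list_span_def symp_dual_def intro: vec.span_zero)
  ultimately have "symp_LCD (list_span (p # L))"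
    by (auto simp: symp_LCD_def)
  moreover have "card (list_span (p # L)) = CARD('a) ^ (2 * length (p # L))"
    using card_plane_sum[OF uv sub] Cons.IH L(2)
    by (simp add: p list_span_Cons power2_eq_square)
  ultimately show ?case by blast
qed

subsection \<open>Double counting\<close>

lemma mem_SLCD_iff:
  fixes C :: "('a::{field,finite} ^ ('n::finite + 'n)) set"
  shows "C \<in> SLCD (2 * CARD('n)) d \<longleftrightarrow> vec.subspace C \<and> card C = CARD('a) ^ d \<and> symp_LCD C"
  using dim_eq_iff_card[of C d] by (auto simp: SLCD_def linear_code_def mult_2)

text \<open>The span is contained in \<open>C\<close> and has the same cardinality. A list therefore
  determines its code, which makes the double count disjoint.\<close>

lemma list_span_eq:
  fixes C :: "('a::{field,finite} ^ ('n::finite + 'n)) set"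
  assumes "C \<in> SLCD (2 * CARD('n)) (2 * k)" "L \<in> hyperbolic_lists k C"
  shows "list_span L = C"
proof (rule card_subset_eq)
  show "list_span L \<subseteq> C"
    using assms unfolding list_span_def
    by (intro vec.span_minimal) (auto simp: mem_SLCD_iff hyperbolic_lists_def)
  show "card (list_span L) = card C"
    using assms hyperbolic_span[of L] by (auto simp: mem_SLCD_iff hyperbolic_lists_def)
qed simp

lemma card_SLCD_mult:
  "card (SLCD (2 * CARD('n)) (2 * k) :: ('a::{field,finite} ^ ('n::finite + 'n)) set set) *
      (\<Prod>i<k. (CARD('a) ^ (2 * (k - i)) - 1) * CARD('a) ^ (2 * (k - i) - 1)) =
    card (hyperbolic_lists k (UNIV :: ('a ^ ('n + 'n)) set))"
proof -
  let ?X = "SLCD (2 * CARD('n)) (2 * k) :: ('a ^ ('n + 'n)) set set"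
  \<comment> \<open>Sort the lists of the ambient space by the code they span.\<close>
  have "hyperbolic_lists k UNIV = (\<Union>C\<in>?X. hyperbolic_lists k C)"
  proof (intro subset_antisym subsetI)
    fix L :: "(('a ^ ('n + 'n)) \<times> ('a ^ ('n + 'n))) list"
    assume L: "L \<in> hyperbolic_lists k UNIV"
    then have "list_span L \<in> ?X"
      using hyperbolic_span[of L] by (auto simp: mem_SLCD_iff hyperbolic_lists_def list_span_def)
    moreover have "L \<in> hyperbolic_lists k (list_span L)"
      using L by (auto simp: hyperbolic_lists_def list_span_def intro!: vec.span_base rev_image_eqI)
    ultimately show "L \<in> (\<Union>C\<in>?X. hyperbolic_lists k C)" by blast
  qed (auto simp: hyperbolic_lists_def)
  moreover have "card (\<Union>C\<in>?X. hyperbolic_lists k C) = (\<Sum>C\<in>?X. card (hyperbolic_lists k C))"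
    using list_span_eq[where k=k] by (intro card_UN_disjoint) (simp, simp, blast)
  moreover have "card (hyperbolic_lists k C) =
      (\<Prod>i<k. (CARD('a) ^ (2 * (k - i)) - 1) * CARD('a) ^ (2 * (k - i) - 1))" if "C \<in> ?X" for C
    using that by (intro card_hyperbolic_lists) (auto simp: mem_SLCD_iff)
  ultimately show ?thesis by simp
qed

text \<open>The identity holds factor by factor; the \<open>k\<close> equal powers
  \<open>q ^ (2 * (n - k))\<close> then combine into the leading power.\<close>

lemma hyperbolic_count_ratio:
  fixes q :: real
  assumes "q > 1" "k \<le> n"
  shows "(\<Prod>i<k. (q ^ (2 * (n - i)) - 1) * q ^ (2 * (n - i) - 1)) =
    q ^ (2 * k * (n - k)) * gaussian_binomial (q ^ 2) n k *
    (\<Prod>i<k. (q ^ (2 * (k - i)) - 1) * q ^ (2 * (k - i) - 1))"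
proof -
  have "(q ^ (2 * (n - i)) - 1) * q ^ (2 * (n - i) - 1) =
      q ^ (2 * (n - k)) * (((q ^ 2) ^ n - (q ^ 2) ^ i) / ((q ^ 2) ^ k - (q ^ 2) ^ i)) *
      ((q ^ (2 * (k - i)) - 1) * q ^ (2 * (k - i) - 1))" if "i < k" for i
  proof -
    \<comment> \<open>Pulling out \<open>(q ^ 2) ^ i\<close> from numerator and denominator of the
      Gaussian factor makes it cancel.\<close>
    have split: "(q ^ 2) ^ m - (q ^ 2) ^ i = (q ^ 2) ^ i * (q ^ (2 * (m - i)) - 1)" if "i \<le> m" for m
    proof -
      have "2 * m = 2 * i + 2 * (m - i)" using that by simp
      then have "q ^ (2 * m) = q ^ (2 * i) * q ^ (2 * (m - i))" by (metis power_add)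
      then show ?thesis by (simp add: power_mult[symmetric] algebra_simps)
    qed
    \<comment> \<open>Since \<open>i < k\<close>, the natural subtraction of 1 does not
      truncate.\<close>
    have "2 * (n - i) - 1 = 2 * (n - k) + (2 * (k - i) - 1)"
      using that assms by simp
    then have "q ^ (2 * (n - i) - 1) = q ^ (2 * (n - k)) * q ^ (2 * (k - i) - 1)"
      by (metis power_add)
    moreover have "q ^ (2 * (k - i)) \<noteq> 1"
      using assms that by (intro less_imp_neq[THEN not_sym] one_less_power) auto
    ultimately show ?thesis
      using that assms by (simp add: split)
  qed
  then have "(\<Prod>i<k. (q ^ (2 * (n - i)) - 1) * q ^ (2 * (n - i) - 1)) =
      (\<Prod>i<k. q ^ (2 * (n - k)) * (((q ^ 2) ^ n - (q ^ 2) ^ i) / ((q ^ 2) ^ k - (q ^ 2) ^ i)) *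
        ((q ^ (2 * (k - i)) - 1) * q ^ (2 * (k - i) - 1)))"
    by (intro prod.cong) auto
  moreover have "(q ^ (2 * (n - k))) ^ k = q ^ (2 * k * (n - k))"
    by (simp add: ac_simps flip: power_mult)
  ultimately show ?thesis
    by (simp add: gaussian_binomial_def prod.distrib prod_dividef)
qed

theorem theorem4p8:
  fixes q n k :: nat
  assumes "primepow q"
    and "CARD('a::{field,finite}) = q"
    and "CARD('n::finite) = n"
    and "0 < k" and "k < n"
  shows "real (card (SLCD (2 * n) (2 * k) :: ('a ^ ('n + 'n)) set set)) =
    real q ^ (2 * k * (n - k)) * gaussian_binomial (real q ^ 2) n k"
proof -
  let ?N = "\<lambda>m. \<Prod>i<k. (q ^ (2 * (m - i)) - 1) * q ^ (2 * (m - i) - 1)"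
  let ?R = "\<lambda>m. \<Prod>i<k. (real q ^ (2 * (m - i)) - 1) * real q ^ (2 * (m - i) - 1)"
  have q: "q > 1" using card_field_gt_1[where 'a='a] assms by simp
  \<comment> \<open>As \<open>q > 1\<close>, each power is at least 1, so subtracting 1 in the
    naturals agrees with the real subtraction.\<close>
  then have real_N: "real (?N m) = ?R m" for m
    by simp
  have "card (hyperbolic_lists k (UNIV :: ('a ^ ('n + 'n)) set)) = ?N n"
    using card_hyperbolic_lists[of "UNIV :: ('a ^ ('n + 'n)) set" n k] assms
    by (simp add: symp_LCD_UNIV mult_2)
  then have "card (SLCD (2 * n) (2 * k) :: ('a ^ ('n + 'n)) set set) * ?N k = ?N n"
    using card_SLCD_mult[where 'a='a and 'n='n and k=k] assms by simp
  then have "real (card (SLCD (2 * n) (2 * k) :: ('a ^ ('n + 'n)) set set)) * ?R k = ?R n"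
    by (simp only: real_N[symmetric] of_nat_mult[symmetric])
  also have "\<dots> = real q ^ (2 * k * (n - k)) * gaussian_binomial (real q ^ 2) n k * ?R k"
    using q assms by (intro hyperbolic_count_ratio) auto
  finally have eq: "real (card (SLCD (2 * n) (2 * k) :: ('a ^ ('n + 'n)) set set)) * ?R k =
    real q ^ (2 * k * (n - k)) * gaussian_binomial (real q ^ 2) n k * ?R k" .
  have "real q ^ (2 * (k - i)) > 1" if "i < k" for i
    using q that by (intro one_less_power) auto
  \<comment> \<open>Every factor is positive, which permits cancelling the number of lists inside a
    single code.\<close>
  then have R: "?R k \<noteq> 0"
    using q by (auto simp: prod_zero_iff less_imp_neq[THEN not_sym])
  show ?thesis
    using eq by (simp only: mult_right_cancel[OF R])
qed

end
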